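(* Let $T$ be a tree of order $n\ge4$ which is not isomorphic to the star $K_{1,n-1}$. Then $\xi_1(T^c)\le\xi_1\big((T_{n,3}^{0,n-4})^c\big)$, with equality if and only if $T\cong T_{n,3}^{0,n-4}$.
   Context: For a connected graph $G$, the eccentricity matrix $\mathcal{E}(G)$ is the matrix indexed by $V(G)$ whose $(u,v)$-entry is $d_G(u,v)$ if $d_G(u,v)=\min\{e_G(u),e_G(v)\}$ and $0$ otherwise, where $d_G$ is the graph distance and $e_G(u)=\max_v d_G(u,v)$. $\xi_1(G)$ denotes the largest eigenvalue of $\mathcal{E}(G)$. $T^c$ is the complement of $T$. $T_{n,3}^{0,n-4}$ is the tree on $n$ vertices obtained from the path $v_0v_1v_2v_3$ by attaching $n-4$ pendant vertices to $v_2$. *)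

theory Defs
  imports
    "Graph_Theory.Graph_Theory"
    "Jordan_Normal_Form.Char_Poly"
begin

text \<open>
  A finite simple graph is a \<^locale>\<open>pair_graph\<close>: a finite, loop-free and symmetric set of
  vertex pairs, where the undirected edge \<open>uv\<close> is represented by the two arcs \<open>(u, v)\<close> and
  \<open>(v, u)\<close>. The library predicate \<^const>\<open>tree\<close> is meant for orientations: it counts the walk
  \<open>u \<rightarrow> v \<rightarrow> u\<close> along a single undirected edge as a cycle. Cycles of an undirected graph are the
  directed cycles of length at least 3.
\<close>

definition undirected_tree :: "'a pair_pre_digraph \<Rightarrow> bool" where
  "undirected_tree G \<longleftrightarrow> pair_graph G \<and> connected (with_proj G) \<and>
     \<not> (\<exists>p. pre_digraph.cycle (with_proj G) p \<and> length p \<ge> 3)"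

definition complement :: "'a pair_pre_digraph \<Rightarrow> 'a pair_pre_digraph" where
  "complement G = \<lparr>pverts = pverts G,
     parcs = {(u, v). u \<in> pverts G \<and> v \<in> pverts G \<and> u \<noteq> v \<and> (u, v) \<notin> parcs G}\<rparr>"

definition graph_dist :: "'a pair_pre_digraph \<Rightarrow> 'a \<Rightarrow> 'a \<Rightarrow> ereal" where
  "graph_dist G u v = wf_digraph.\<mu> (with_proj G) (\<lambda>_. 1) u v"

definition ecc :: "'a pair_pre_digraph \<Rightarrow> 'a \<Rightarrow> ereal" where
  "ecc G u = Max (graph_dist G u ` pverts G)"

text \<open>
  For a connected graph all distances are finite, so \<^const>\<open>real_of_ereal\<close> loses nothing.
\<close>

definition ecc_entry :: "'a pair_pre_digraph \<Rightarrow> 'a \<Rightarrow> 'a \<Rightarrow> real" where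
  "ecc_entry G u v =
     (if graph_dist G u v = min (ecc G u) (ecc G v) then real_of_ereal (graph_dist G u v) else 0)"

text \<open>
  Matrices of the library are indexed by \<open>{0..<n}\<close>, so the vertices have to be listed in some order
  \<open>vs\<close>. A different order conjugates the matrix by a permutation matrix, hence the choice of the
  order in the definition of \<open>\<xi>\<^sub>1\<close> does not affect the eigenvalues.
\<close>

definition ecc_mat :: "'a pair_pre_digraph \<Rightarrow> 'a list \<Rightarrow> real mat" where
  "ecc_mat G vs = mat (length vs) (length vs) (\<lambda>(i, j). ecc_entry G (vs ! i) (vs ! j))"

definition vertex_order :: "'a pair_pre_digraph \<Rightarrow> 'a list" where
  "vertex_order G = (SOME vs. distinct vs \<and> set vs = pverts G)"

text \<open>
  The eccentricity matrix is real symmetric, so all its eigenvalues are real.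
\<close>

definition xi1 :: "'a pair_pre_digraph \<Rightarrow> real" where
  "xi1 G = Max {x. eigenvalue (ecc_mat G (vertex_order G)) x}"

text \<open>
  The tree \<open>T\<^sub>n\<^sub>,\<^sub>3\<close> with superscripts \<open>0\<close> and \<open>n - 4\<close>: the path on \<open>0, 1, 2, 3\<close> with the vertices
  \<open>4, \<dots>, n - 1\<close> attached to \<open>2\<close>. Meaningful only for \<open>n \<ge> 4\<close>.
\<close>

definition T_n3 :: "nat \<Rightarrow> nat pair_pre_digraph" where
  "T_n3 n = \<lparr>pverts = {0..<n},
     parcs = symcl ({(0, 1), (1, 2), (2, 3)} \<union> {2} \<times> {4..<n})\<rparr>"

end

theory Submission
  imports Defs "Jordan_Normal_Form.Spectral_Radius"
begin

text \<open>
  In the complement of a tree that is not a star, non-adjacent vertices of the tree have distance 1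
  and all eccentricities are at least 2, so only edges of the tree contribute to the eccentricity
  matrix. If no edge dominates the tree, then the matrix is twice the adjacency matrix. Its square
  has row sums at most \<open>4 (n - 1)\<close>, since a tree has no triangles and 4-cycles, and therefore
  \<open>\<xi>\<^sub>1 \<le> 2 \<surd>(n - 1)\<close>. If the edge \<open>uv\<close> dominates, then the tree is a double star with
  \<open>a\<close> and \<open>b\<close> leaves at \<open>u\<close> and \<open>v\<close>, where \<open>a + b = n - 2\<close> and \<open>a, b \<ge> 1\<close>. Its eccentricity
  matrix has the entry 3 at \<open>uv\<close> and 2 at the pendant edges, and the non-zero eigenvalues solve
  \<open>(\<lambda>\<^sup>2 - 4 a) (\<lambda>\<^sup>2 - 4 b) = 9 \<lambda>\<^sup>2\<close>. The largest solution is strictly decreasing in \<open>a b\<close>, which is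
  minimal exactly for \<open>{a, b} = {1, n - 3}\<close>, and for these values it exceeds \<open>2 \<surd>(n - 1)\<close>.
\<close>

subsection \<open>Eigenvalues of eccentricity matrices\<close>

text \<open>The right-hand side depends on \<open>vs\<close> only through \<open>set vs\<close>, so
  the arbitrary vertex order drops out and eigenvectors become functions on vertices. The field is
  general because both real and complex matrices are treated.\<close>

lemma eigenvalue_vertex_mat_iff:
  fixes e :: "'a \<Rightarrow> 'a \<Rightarrow> 'b::field"
  assumes "distinct vs"
  shows "eigenvalue (mat (length vs) (length vs) (\<lambda>(i, j). e (vs ! i) (vs ! j))) x \<longleftrightarrow>
    (\<exists>f. (\<exists>v\<in>set vs. f v \<noteq> 0) \<and> (\<forall>u\<in>set vs. (\<Sum>v\<in>set vs. e u v * f v) = x * f u))"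
    (is "eigenvalue ?A x \<longleftrightarrow> ?R")
proof -
  let ?n = "length vs"
  have bij: "bij_betw ((!) vs) {0..<?n} (set vs)"
    using assms by (simp add: bij_betw_nth atLeast0LessThan)
  have mult: "(?A *\<^sub>v w) $ i = (\<Sum>v\<in>set vs. e (vs ! i) v * f v)"
    if "i < ?n" "w \<in> carrier_vec ?n" "\<And>i. i < ?n \<Longrightarrow> w $ i = f (vs ! i)" for w f i
    using that by (auto simp: scalar_prod_def sum.reindex_bij_betw[OF bij, symmetric] intro!: sum.cong)
  show ?thesis
  proof
    assume "eigenvalue ?A x"
    then obtain w where w: "w \<in> carrier_vec ?n" "w \<noteq> 0\<^sub>v ?n" "?A *\<^sub>v w = x \<cdot>\<^sub>v w"
      by (auto simp: eigenvalue_def eigenvector_def)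
    define f where "f v = w $ (the_inv_into {0..<?n} ((!) vs) v)" for v
    have f: "w $ i = f (vs ! i)" if "i < ?n" for i
      using that bij by (simp add: f_def the_inv_into_f_f bij_betw_def)
    obtain i where "i < ?n" "w $ i \<noteq> 0"
      using w by (metis carrier_vecD eq_vecI index_zero_vec(1,2))
    then have "\<exists>v\<in>set vs. f v \<noteq> 0" using f by (metis nth_mem)
    moreover have "(\<Sum>v\<in>set vs. e u v * f v) = x * f u" if "u \<in> set vs" for u
    proof -
      obtain i where i: "i < ?n" "vs ! i = u" using \<open>u \<in> set vs\<close> by (metis in_set_conv_nth)
      have "(x \<cdot>\<^sub>v w) $ i = (\<Sum>v\<in>set vs. e (vs ! i) v * f v)"
        using mult[OF i(1) w(1) f] w(3) by simp
      then show ?thesis using i w(1) f by simp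
    qed
    ultimately show ?R by blast
  next
    assume ?R
    then obtain f where f: "\<exists>v\<in>set vs. f v \<noteq> 0"
      "\<And>u. u \<in> set vs \<Longrightarrow> (\<Sum>v\<in>set vs. e u v * f v) = x * f u" by blast
    define w where "w = vec ?n (\<lambda>i. f (vs ! i))"
    have w: "w \<in> carrier_vec ?n" "\<And>i. i < ?n \<Longrightarrow> w $ i = f (vs ! i)" by (auto simp: w_def)
    have "w \<noteq> 0\<^sub>v ?n"
    proof
      assume "w = 0\<^sub>v ?n"
      then have "f (vs ! i) = 0" if "i < ?n" for i using w(2)[OF that] that by simp
      then show False using f(1) by (auto simp: in_set_conv_nth)
    qed
    moreover have "?A *\<^sub>v w = x \<cdot>\<^sub>v w"
    proof (rule eq_vecI)
      fix i assume "i < dim_vec (x \<cdot>\<^sub>v w)"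
      then have "i < ?n" using w by simp
      then show "(?A *\<^sub>v w) $ i = (x \<cdot>\<^sub>v w) $ i" using mult[OF _ w(1) w(2)] f(2) w(2) w(1) by simp
    qed (use w in simp)
    ultimately show "eigenvalue ?A x"
      using w(1) by (auto simp: eigenvalue_def eigenvector_def)
  qed
qed

text \<open>Over the complex numbers some eigenvalue \<open>z\<close> exists. For an eigenvector
  \<open>f\<close> with squared norm \<open>N\<close>, the Hermitian form \<open>Q\<close> equals
  \<open>z * N\<close>. Symmetry makes \<open>Q\<close> real and \<open>N\<close> is a positive
  real, so \<open>z\<close> is real and hence a root of the real characteristic polynomial.\<close>

lemma symmetric_kernel_has_real_eigenvalue:
  fixes e :: "'a \<Rightarrow> 'a \<Rightarrow> real"
  assumes vs: "distinct vs" "vs \<noteq> []" and sym: "\<And>u v. u \<in> set vs \<Longrightarrow> v \<in> set vs \<Longrightarrow> e u v = e v u"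
  shows "\<exists>x. eigenvalue (mat (length vs) (length vs) (\<lambda>(i, j). e (vs ! i) (vs ! j))) x"
proof -
  let ?n = "length vs" and ?V = "set vs"
  define A where "A = mat ?n ?n (\<lambda>(i, j). e (vs ! i) (vs ! j))"
  define C where "C = mat ?n ?n (\<lambda>(i, j). complex_of_real (e (vs ! i) (vs ! j)))"
  have A: "A \<in> carrier_mat ?n ?n" and C: "C \<in> carrier_mat ?n ?n" by (auto simp: A_def C_def)
  have CA: "C = map_mat complex_of_real A" by (auto simp: A_def C_def)
  obtain z where z: "eigenvalue C z"
    using spectrum_non_empty[OF C] vs(2) by (auto simp: spectrum_def)
  then obtain f where f: "\<exists>v\<in>?V. f v \<noteq> 0"
    "\<And>u. u \<in> ?V \<Longrightarrow> (\<Sum>v\<in>?V. complex_of_real (e u v) * f v) = z * f u"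
    using eigenvalue_vertex_mat_iff[OF vs(1), of "\<lambda>u v. complex_of_real (e u v)" z]
    by (auto simp: C_def)
  define N where "N = (\<Sum>u\<in>?V. cnj (f u) * f u)"
  define Q where "Q = (\<Sum>u\<in>?V. \<Sum>v\<in>?V. cnj (f u) * complex_of_real (e u v) * f v)"
  have N: "N = complex_of_real (\<Sum>u\<in>?V. (cmod (f u))\<^sup>2)"
    unfolding N_def of_real_sum by (rule sum.cong) (simp_all add: complex_norm_square mult.commute del: of_real_power)
  have "(\<Sum>u\<in>?V. (cmod (f u))\<^sup>2) > 0"
    using f(1) by (auto intro!: sum_pos2)
  then have N0: "N \<noteq> 0" and Ncnj: "cnj N = N" unfolding N by (auto simp del: of_real_sum)
  have QN: "Q = z * N"
    unfolding Q_def N_def sum_distrib_left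
    by (rule sum.cong) (auto simp: f(2)[symmetric] mult.assoc sum_distrib_left[symmetric] mult.left_commute[of z])
  have "cnj Q = (\<Sum>u\<in>?V. \<Sum>v\<in>?V. f u * complex_of_real (e u v) * cnj (f v))"
    by (simp add: Q_def)
  also have "\<dots> = (\<Sum>v\<in>?V. \<Sum>u\<in>?V. f u * complex_of_real (e u v) * cnj (f v))"
    by (rule sum.swap)
  also have "\<dots> = Q"
    unfolding Q_def by (intro sum.cong refl) (simp add: sym mult_ac)
  finally have "cnj z = z" using QN N0 Ncnj by simp
  then have "z = complex_of_real (Re z)" by (simp add: complex_eq_iff)
  moreover have "poly (char_poly C) z = 0"
    using z eigenvalue_root_char_poly[OF C] by simp
  ultimately have "poly (map_poly complex_of_real (char_poly A)) (complex_of_real (Re z)) = 0"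
    unfolding CA of_real_hom.char_poly_hom[OF A] by simp
  then have "poly (char_poly A) (Re z) = 0"
    by (metis of_real_hom.poly_map_poly of_real_eq_0_iff)
  then show ?thesis using eigenvalue_root_char_poly[OF A] unfolding A_def by blast
qed

lemma vertex_order:
  assumes "finite (pverts G)"
  shows "distinct (vertex_order G)" "set (vertex_order G) = pverts G"
  using someI_ex[of "\<lambda>vs. distinct vs \<and> set vs = pverts G"] finite_distinct_list[OF assms]
  unfolding vertex_order_def by auto

lemma eigenvalue_ecc_mat_iff:
  assumes "finite (pverts G)"
  shows "eigenvalue (ecc_mat G (vertex_order G)) x \<longleftrightarrow>
    (\<exists>f. (\<exists>v\<in>pverts G. f v \<noteq> 0) \<and>
      (\<forall>u\<in>pverts G. (\<Sum>v\<in>pverts G. ecc_entry G u v * f v) = x * f u))"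
  using eigenvalue_vertex_mat_iff[of "vertex_order G" "ecc_entry G" x] vertex_order[OF assms]
  by (simp add: ecc_mat_def)

lemma finite_eigenvalues_ecc_mat: "finite {x. eigenvalue (ecc_mat G vs) x}"
  using card_finite_spectrum(1)[of "ecc_mat G vs" "length vs"] by (auto simp: spectrum_def ecc_mat_def)

lemma xi1_eqI:
  assumes "finite (pverts G)"
    and "\<exists>v\<in>pverts G. f v \<noteq> 0"
      "\<And>u. u \<in> pverts G \<Longrightarrow> (\<Sum>v\<in>pverts G. ecc_entry G u v * f v) = x * f u"
    and "\<And>y g. \<exists>v\<in>pverts G. g v \<noteq> 0 \<Longrightarrow>
      \<forall>u\<in>pverts G. (\<Sum>v\<in>pverts G. ecc_entry G u v * g v) = y * g u \<Longrightarrow> y \<le> x"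
  shows "xi1 G = x"
  unfolding xi1_def
proof (rule Max_eqI)
  show "x \<in> {x. eigenvalue (ecc_mat G (vertex_order G)) x}"
    using assms(2,3) by (auto simp: eigenvalue_ecc_mat_iff[OF assms(1)])
  show "y \<le> x" if "y \<in> {x. eigenvalue (ecc_mat G (vertex_order G)) x}" for y
    using that assms(4) by (auto simp: eigenvalue_ecc_mat_iff[OF assms(1)])
qed (rule finite_eigenvalues_ecc_mat)

text \<open>Symmetry guarantees that the set of real eigenvalues, whose maximum is taken, is not empty.\<close>

lemma xi1_eigenvector:
  assumes "finite (pverts G)" "pverts G \<noteq> {}"
    and "\<And>u v. u \<in> pverts G \<Longrightarrow> v \<in> pverts G \<Longrightarrow> ecc_entry G u v = ecc_entry G v u"
  shows "\<exists>f. (\<exists>v\<in>pverts G. f v \<noteq> 0) \<and>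
    (\<forall>u\<in>pverts G. (\<Sum>v\<in>pverts G. ecc_entry G u v * f v) = xi1 G * f u)"
proof -
  let ?S = "{x. eigenvalue (ecc_mat G (vertex_order G)) x}"
  have "?S \<noteq> {}"
    using symmetric_kernel_has_real_eigenvalue[of "vertex_order G" "ecc_entry G"]
      vertex_order[OF assms(1)] assms(2,3) by (fastforce simp: ecc_mat_def)
  then have "xi1 G \<in> ?S"
    unfolding xi1_def using finite_eigenvalues_ecc_mat by (intro Max_in) auto
  then show ?thesis by (simp add: eigenvalue_ecc_mat_iff[OF assms(1)])
qed

subsection \<open>Distances in complements\<close>

lemma graph_dist_conv:
  fixes G :: "'a pair_pre_digraph"
  assumes "pair_wf_digraph G"
  shows "graph_dist G u v =
    (INF p\<in>{p. u \<in> pverts G \<and> set p \<subseteq> parcs G \<and> pcas u p v}. ereal (real (length p)))"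
proof -
  interpret pair_wf_digraph G by fact
  have "awalk_cost (\<lambda>_. 1) p = real (length p)" for p :: "('a \<times> 'a) list"
    by (induction p) auto
  then show ?thesis
    by (simp add: graph_dist_def \<mu>_def awalk_def)
qed

lemma graph_dist_eqI:
  assumes "pair_wf_digraph G" "u \<in> pverts G" "set p \<subseteq> parcs G" "pcas u p v"
    and "\<And>q. set q \<subseteq> parcs G \<Longrightarrow> pcas u q v \<Longrightarrow> length p \<le> length q"
  shows "graph_dist G u v = ereal (real (length p))"
  unfolding graph_dist_conv[OF assms(1)]
proof (rule antisym)
  show "(INF p\<in>{p. u \<in> pverts G \<and> set p \<subseteq> parcs G \<and> pcas u p v}. ereal (real (length p)))
    \<le> ereal (real (length p))"
    using assms by (intro INF_lower) auto
qed (auto intro!: INF_greatest assms)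

lemma graph_dist_self:
  assumes "pair_wf_digraph G" "u \<in> pverts G"
  shows "graph_dist G u u = 0"
  using graph_dist_eqI[of G u "[]" u] assms by (simp add: zero_ereal_def)

lemma graph_dist_1:
  assumes "pair_wf_digraph G" "(u, v) \<in> parcs G" "u \<noteq> v"
  shows "graph_dist G u v = 1"
proof -
  have "graph_dist G u v = ereal (real (length [(u, v)]))"
  proof (rule graph_dist_eqI)
    show "length [(u, v)] \<le> length q" if "pcas u q v" for q
      using that assms(3) by (cases q) auto
  qed (use assms in \<open>auto dest: pair_wf_digraph.in_arcsD1\<close>)
  then show ?thesis by (simp add: one_ereal_def)
qed

lemma graph_dist_2:
  assumes "pair_wf_digraph G" "(u, w) \<in> parcs G" "(w, v) \<in> parcs G" "u \<noteq> v" "(u, v) \<notin> parcs G"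
  shows "graph_dist G u v = 2"
proof -
  have "graph_dist G u v = ereal (real (length [(u, w), (w, v)]))"
  proof (rule graph_dist_eqI)
    show "length [(u, w), (w, v)] \<le> length q" if "set q \<subseteq> parcs G" "pcas u q v" for q
      using that assms(4,5) by (cases q; cases "tl q") (auto simp: neq_Nil_conv)
  qed (use assms in \<open>auto dest: pair_wf_digraph.in_arcsD1\<close>)
  then show ?thesis by simp
qed

lemma graph_dist_3:
  assumes "pair_wf_digraph G" "(u, w) \<in> parcs G" "(w, z) \<in> parcs G" "(z, v) \<in> parcs G"
    "u \<noteq> v" "(u, v) \<notin> parcs G" "\<And>y. (u, y) \<in> parcs G \<Longrightarrow> (y, v) \<notin> parcs G"
  shows "graph_dist G u v = 3"
proof -
  have "graph_dist G u v = ereal (real (length [(u, w), (w, z), (z, v)]))"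
  proof (rule graph_dist_eqI)
    show "length [(u, w), (w, z), (z, v)] \<le> length q" if q: "set q \<subseteq> parcs G" "pcas u q v" for q
    proof (rule ccontr)
      assume "\<not> ?thesis"
      then have "length q < 3" by simp
      then have "length q = 0 \<or> length q = 1 \<or> length q = 2" by linarith
      then show False
        using q assms(5-7) by (auto simp: length_Suc_conv numeral_2_eq_2)
    qed
  qed (use assms in \<open>auto dest: pair_wf_digraph.in_arcsD1\<close>)
  then show ?thesis by simp
qed

lemma ecc_eqI:
  assumes "finite (pverts G)" "v \<in> pverts G" "graph_dist G u v = k"
    "\<And>w. w \<in> pverts G \<Longrightarrow> graph_dist G u w \<le> k"
  shows "ecc G u = k"
  unfolding ecc_def by (rule Max_eqI) (use assms in auto)

lemma ecc_ge:
  assumes "finite (pverts G)" "v \<in> pverts G"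
  shows "graph_dist G u v \<le> ecc G u"
  unfolding ecc_def by (rule Max_ge) (use assms in auto)

lemma pverts_complement [simp]: "pverts (complement G) = pverts G"
  by (simp add: complement_def)

lemma parcs_complement:
  "(u, v) \<in> parcs (complement G) \<longleftrightarrow> u \<in> pverts G \<and> v \<in> pverts G \<and> u \<noteq> v \<and> (u, v) \<notin> parcs G"
  by (simp add: complement_def)

lemma pair_wf_digraph_complement: "pair_wf_digraph (complement G)"
  by unfold_locales (auto simp: complement_def)

lemma ecc_entry_self:
  assumes "pair_wf_digraph G" "u \<in> pverts G"
  shows "ecc_entry G u u = 0"
  using graph_dist_self[OF assms] by (simp add: ecc_entry_def)

subsection \<open>Graphs without a dominating edge\<close>

text \<open>Adjacent vertices of \<open>G\<close> are distinct and not adjacent in the complement,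
  so no walk between them is shorter than 2. If no walk exists, the infimum is infinite and the
  bound still holds.\<close>

lemma ecc_complement_ge_2:
  assumes G: "pair_graph G" and uv: "(u, v) \<in> parcs G"
  shows "ecc (complement G) u \<ge> 2"
proof -
  interpret pair_graph G by fact
  have V: "u \<in> pverts G" "v \<in> pverts G" "u \<noteq> v"
    using uv in_arcsD1 in_arcsD2 pair_no_loops by fastforce+
  have "2 \<le> graph_dist (complement G) u v"
    unfolding graph_dist_conv[OF pair_wf_digraph_complement]
  proof (rule INF_greatest)
    fix p assume "p \<in> {p. u \<in> pverts (complement G) \<and> set p \<subseteq> parcs (complement G) \<and> pcas u p v}"
    then have p: "set p \<subseteq> parcs (complement G)" "pcas u p v" by auto
    have "length p \<ge> 2"
    proof (rule ccontr)
      assume "\<not> ?thesis"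
      then have "length p = 0 \<or> length p = 1" by linarith
      then show False
        using p V(3) uv by (auto simp: length_Suc_conv parcs_complement)
    qed
    then show "2 \<le> ereal (real (length p))" by simp
  qed
  also have "\<dots> \<le> ecc (complement G) u"
    using pair_finite_verts V by (intro ecc_ge) auto
  finally show ?thesis .
qed

text \<open>Distance 1 lies strictly below both eccentricities, so it never equals their
  minimum.\<close>

lemma ecc_entry_complement_not_adj:
  assumes G: "pair_graph G" and nbr: "\<And>w. w \<in> pverts G \<Longrightarrow> \<exists>z. (w, z) \<in> parcs G"
    and V: "u \<in> pverts G" "v \<in> pverts G" and uv: "(u, v) \<notin> parcs G"
  shows "ecc_entry (complement G) u v = 0"
proof (cases "u = v")
  case True
  then show ?thesis using ecc_entry_self[OF pair_wf_digraph_complement] V by simp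
next
  case False
  then have "graph_dist (complement G) u v = 1"
    using V uv by (intro graph_dist_1 pair_wf_digraph_complement) (auto simp: parcs_complement)
  moreover have "2 \<le> min (ecc (complement G) u) (ecc (complement G) v)"
    using nbr V ecc_complement_ge_2[OF G] by (meson min.boundedI)
  moreover have "\<not> (2::ereal) \<le> 1" by simp
  ultimately show ?thesis unfolding ecc_entry_def by metis
qed

text \<open>The vertex \<open>w\<close>, which witnesses that \<open>uv\<close> does not dominate,
  is a common neighbour of \<open>u\<close> and \<open>v\<close> in the complement.\<close>

lemma graph_dist_complement_adj:
  assumes G: "pair_graph G" and uv: "(u, v) \<in> parcs G"
    and w: "w \<in> pverts G" "w \<noteq> u" "w \<noteq> v" "(u, w) \<notin> parcs G" "(v, w) \<notin> parcs G"
  shows "graph_dist (complement G) u v = 2"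
proof -
  interpret pair_graph G by fact
  have V: "u \<in> pverts G" "v \<in> pverts G" "u \<noteq> v"
    using uv in_arcsD1 in_arcsD2 pair_no_loops by fastforce+
  have "(w, v) \<notin> parcs G" using w arcs_symmetric by blast
  then show ?thesis using V w uv
    by (intro graph_dist_2[of _ u w] pair_wf_digraph_complement) (auto simp: parcs_complement)
qed

lemma ecc_complement_no_dominating_edge:
  assumes G: "pair_graph G" and nbr: "\<And>w. w \<in> pverts G \<Longrightarrow> \<exists>z. (w, z) \<in> parcs G"
    and nodom: "\<And>u v. (u, v) \<in> parcs G \<Longrightarrow>
      \<exists>w\<in>pverts G. w \<noteq> u \<and> w \<noteq> v \<and> (u, w) \<notin> parcs G \<and> (v, w) \<notin> parcs G"
    and u: "u \<in> pverts G"
  shows "ecc (complement G) u = 2"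
proof -
  interpret pair_graph G by fact
  obtain z where z: "(u, z) \<in> parcs G" using nbr u by blast
  show ?thesis
  proof (rule ecc_eqI)
    show "z \<in> pverts (complement G)" using z in_arcsD2 by simp
    show "graph_dist (complement G) u z = 2"
      using graph_dist_complement_adj[OF G] nodom z by blast
    fix v assume v: "v \<in> pverts (complement G)"
    consider "u = v" | "u \<noteq> v" "(u, v) \<notin> parcs G" | "(u, v) \<in> parcs G" by blast
    then show "graph_dist (complement G) u v \<le> 2"
    proof cases
      case 1
      then show ?thesis using graph_dist_self[OF pair_wf_digraph_complement] u by fastforce
    next
      case 2
      then have "graph_dist (complement G) u v = 1"
        using u v by (intro graph_dist_1 pair_wf_digraph_complement) (auto simp: parcs_complement)
      then show ?thesis by (metis ereal_less_eq(3) numeral_eq_ereal one_ereal_def one_le_numeral)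
    next
      case 3
      then have "graph_dist (complement G) u v = 2"
        using graph_dist_complement_adj[OF G] nodom by blast
      then show ?thesis by simp
    qed
  qed (simp add: pair_finite_verts)
qed

lemma ecc_entry_complement_no_dominating_edge:
  assumes G: "pair_graph G" and nbr: "\<And>w. w \<in> pverts G \<Longrightarrow> \<exists>z. (w, z) \<in> parcs G"
    and nodom: "\<And>u v. (u, v) \<in> parcs G \<Longrightarrow>
      \<exists>w\<in>pverts G. w \<noteq> u \<and> w \<noteq> v \<and> (u, w) \<notin> parcs G \<and> (v, w) \<notin> parcs G"
    and V: "u \<in> pverts G" "v \<in> pverts G"
  shows "ecc_entry (complement G) u v = (if (u, v) \<in> parcs G then 2 else 0)"
proof (cases "(u, v) \<in> parcs G")
  case True
  then have "graph_dist (complement G) u v = 2"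
    using graph_dist_complement_adj[OF G] nodom by blast
  then show ?thesis
    using ecc_complement_no_dominating_edge[OF G nbr nodom] V True by (simp add: ecc_entry_def)
next
  case False
  then show ?thesis using ecc_entry_complement_not_adj[OF G nbr V] by simp
qed

section \<open>Spectral bound without triangles and 4-cycles\<close>

text \<open>Row sums of the squared adjacency matrix count walks of length two.  Without triangles and
  4-cycles, such a walk \<open>u, v, w\<close> is determined by \<open>w\<close> if \<open>w \<noteq> u\<close> and by \<open>v\<close> otherwise, and no
  vertex arises in both ways.\<close>

lemma card_walks_2_le:
  assumes "pair_graph G" and u: "u \<in> pverts G"
    and no3: "\<And>a b c. (a, b) \<in> parcs G \<Longrightarrow> (b, c) \<in> parcs G \<Longrightarrow> (c, a) \<notin> parcs G"
    and no4: "\<And>a b c d. (a, b) \<in> parcs G \<Longrightarrow> (b, c) \<in> parcs G \<Longrightarrow> (c, d) \<in> parcs G \<Longrightarrow>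
      (d, a) \<in> parcs G \<Longrightarrow> a = c \<or> b = d"
  shows "card (SIGMA v:{v. (u, v) \<in> parcs G}. {w. (v, w) \<in> parcs G}) \<le> card (pverts G) - 1"
proof -
  interpret pair_graph G by fact
  have sym: "(b, a) \<in> parcs G" if "(a, b) \<in> parcs G" for a b using that arcs_symmetric by blast
  have irr: "(a, a) \<notin> parcs G" for a using pair_no_loops by fastforce
  let ?h = "\<lambda>(v, w). if w = u then v else w"
  have "card (SIGMA v:{v. (u, v) \<in> parcs G}. {w. (v, w) \<in> parcs G}) \<le> card (pverts G - {u})"
  proof (rule card_inj_on_le[of ?h])
    show "inj_on ?h (SIGMA v:{v. (u, v) \<in> parcs G}. {w. (v, w) \<in> parcs G})"
    proof (rule inj_onI, clarify)
      fix v w v' w'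
      assume *: "(u, v) \<in> parcs G" "(v, w) \<in> parcs G" "(u, v') \<in> parcs G" "(v', w') \<in> parcs G"
        and eq: "(if w = u then v else w) = (if w' = u then v' else w')"
      show "v = v' \<and> w = w'"
      proof (cases "w = u \<longleftrightarrow> w' = u")
        case True
        then show ?thesis using * eq no4[of u v w v'] sym by (auto split: if_splits)
      next
        case False
        then show ?thesis using * eq no3[of u v w] no3[of u v' w'] sym by (auto split: if_splits)
      qed
    qed
    show "?h ` (SIGMA v:{v. (u, v) \<in> parcs G}. {w. (v, w) \<in> parcs G}) \<subseteq> pverts G - {u}"
      using irr in_arcsD2 by (auto split: if_splits)
  qed (simp add: pair_finite_verts)
  then show ?thesis using u pair_finite_verts by simp
qed

text \<open>The eigenvalue equation is applied twice at a vertex where \<open>f\<close> has maximal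
  modulus \<open>M\<close>. This bounds the square of \<open>x\<close> by the number of walks of
  length two, which is at most the order minus 1. Applying it once would only give the maximum
  degree, which is too weak.\<close>

lemma eigenvalue_sq_le:
  assumes G: "pair_graph G"
    and no3: "\<And>a b c. (a, b) \<in> parcs G \<Longrightarrow> (b, c) \<in> parcs G \<Longrightarrow> (c, a) \<notin> parcs G"
    and no4: "\<And>a b c d. (a, b) \<in> parcs G \<Longrightarrow> (b, c) \<in> parcs G \<Longrightarrow> (c, d) \<in> parcs G \<Longrightarrow>
      (d, a) \<in> parcs G \<Longrightarrow> a = c \<or> b = d"
    and f: "\<exists>v\<in>pverts G. f v \<noteq> 0"
      "\<And>u. u \<in> pverts G \<Longrightarrow> (\<Sum>v\<in>pverts G. (if (u, v) \<in> parcs G then c else 0) * f v) = x * f u"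
  shows "x\<^sup>2 \<le> c\<^sup>2 * (real (card (pverts G)) - 1)"
proof -
  interpret pair_graph G by fact
  let ?V = "pverts G" and ?N = "\<lambda>u. {v. (u, v) \<in> parcs G}"
  have fin: "finite ?V" by (rule pair_finite_verts)
  have N: "?N u \<subseteq> ?V" for u using in_arcsD2 by auto
  then have finN: "finite (?N u)" for u using fin finite_subset by blast
  have eq: "x * f u = c * (\<Sum>v\<in>?N u. f v)" if "u \<in> ?V" for u
  proof -
    have "(\<Sum>v\<in>?N u. c * f v) = (\<Sum>v\<in>?V. (if (u, v) \<in> parcs G then c else 0) * f v)"
      using N by (intro sum.mono_neutral_cong_left fin) auto
    then show ?thesis using f(2)[OF that] by (simp add: sum_distrib_left)
  qed
  define M where "M = Max ((\<lambda>v. \<bar>f v\<bar>) ` ?V)"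
  have "M \<in> (\<lambda>v. \<bar>f v\<bar>) ` ?V" unfolding M_def using f(1) fin by (intro Max_in) auto
  then obtain u where u: "u \<in> ?V" "\<bar>f u\<bar> = M" by auto
  have le: "\<bar>f v\<bar> \<le> M" if "v \<in> ?V" for v
    unfolding M_def using fin that by (intro Max_ge) auto
  have "M > 0" using f(1) le by fastforce
  have "x\<^sup>2 * f u = c * (\<Sum>v\<in>?N u. x * f v)"
    using eq[OF u(1)] by (simp add: power2_eq_square sum_distrib_left[symmetric] mult_ac)
  also have "\<dots> = c\<^sup>2 * (\<Sum>v\<in>?N u. \<Sum>w\<in>?N v. f w)"
    using N eq by (simp add: subset_iff sum_distrib_left power2_eq_square mult.assoc)
  also have "\<dots> = c\<^sup>2 * (\<Sum>(v, w)\<in>(SIGMA v:?N u. ?N v). f w)"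
    using finN by (simp add: sum.Sigma)
  finally have "\<bar>x\<^sup>2 * f u\<bar> = \<bar>c\<^sup>2 * (\<Sum>(v, w)\<in>(SIGMA v:?N u. ?N v). f w)\<bar>"
    by (rule arg_cong)
  then have "x\<^sup>2 * M = c\<^sup>2 * \<bar>\<Sum>(v, w)\<in>(SIGMA v:?N u. ?N v). f w\<bar>"
    by (simp add: abs_mult u(2))
  also have "\<bar>\<Sum>(v, w)\<in>(SIGMA v:?N u. ?N v). f w\<bar> \<le> (\<Sum>(v, w)\<in>(SIGMA v:?N u. ?N v). M)"
    by (rule order_trans[OF sum_abs]) (use le in_arcsD2 in \<open>fastforce intro!: sum_mono\<close>)
  also have "\<dots> = real (card (SIGMA v:?N u. ?N v)) * M" by (simp add: case_prod_beta)
  also have "\<dots> \<le> (real (card ?V) - 1) * M"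
  proof -
    have "card ?V \<ge> 1" using u(1) fin by (simp add: Suc_le_eq card_gt_0_iff) blast
    moreover have "card (SIGMA v:?N u. ?N v) \<le> card ?V - 1"
      by (rule card_walks_2_le[OF G u(1)]) (use no3 no4 in blast)+
    ultimately show ?thesis
      using \<open>M > 0\<close> by (intro mult_right_mono) linarith+
  qed
  finally have "x\<^sup>2 * M \<le> (c\<^sup>2 * (real (card ?V) - 1)) * M" by (simp add: mult_left_mono mult.assoc)
  then show ?thesis using \<open>M > 0\<close> by simp
qed

subsection \<open>Double stars\<close>

text \<open>\<open>A\<close> and \<open>B\<close> are the leaves at the centers \<open>u\<close> and
  \<open>v\<close>. Demanding both to be nonempty excludes stars and provides the walk between the
  centers in the complement.\<close>

locale double_star =
  fixes G :: "'a pair_pre_digraph" and u v :: 'a and A B :: "'a set"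
  assumes pverts_eq: "pverts G = insert u (insert v (A \<union> B))"
    and parcs_eq: "parcs G = symcl (insert (u, v) ({u} \<times> A \<union> {v} \<times> B))"
    and finite_leaves: "finite A" "finite B"
    and nonempty: "A \<noteq> {}" "B \<noteq> {}"
    and disjoint: "A \<inter> B = {}" "u \<notin> A \<union> B" "v \<notin> A \<union> B" "u \<noteq> v"
begin

text \<open>By this symmetry, facts about \<open>u\<close> and \<open>A\<close> need only one proof;
  interpreting the swapped locale gives them for \<open>v\<close> and \<open>B\<close>.\<close>

lemma swap: "double_star G v u B A"
  using finite_leaves nonempty disjoint
  by unfold_locales (auto simp: pverts_eq parcs_eq symcl_def)

lemma mem_pverts: "u \<in> pverts G" "v \<in> pverts G" "A \<subseteq> pverts G" "B \<subseteq> pverts G"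
  by (auto simp: pverts_eq)

lemma finite_pverts: "finite (pverts G)"
  by (simp add: pverts_eq finite_leaves)

lemma card_pverts: "card (pverts G) = card A + card B + 2"
  using finite_leaves disjoint by (simp add: pverts_eq card_Un_disjoint)

lemma arc_iff:
  "(x, y) \<in> parcs G \<longleftrightarrow> x = u \<and> (y = v \<or> y \<in> A) \<or> x = v \<and> (y = u \<or> y \<in> B) \<or>
    x \<in> A \<and> y = u \<or> x \<in> B \<and> y = v"
  by (auto simp: parcs_eq symcl_def)

lemma co_arc_iff:
  "(x, y) \<in> parcs (complement G) \<longleftrightarrow> x \<noteq> y \<and>
    (x = u \<and> y \<in> B \<or> x = v \<and> y \<in> A \<or> x \<in> A \<and> y \<in> insert v (A \<union> B) \<or>
     x \<in> B \<and> y \<in> insert u (A \<union> B))"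
  using disjoint by (auto simp: parcs_complement arc_iff pverts_eq)

text \<open>In the complement \<open>u\<close> is adjacent only to \<open>B\<close> and
  \<open>v\<close> only to \<open>A\<close>. These sets are disjoint, so the walk \<open>u\<close>,
  \<open>b\<close>, \<open>a\<close>, \<open>v\<close> is shortest.\<close>

lemma dist_centers: "graph_dist (complement G) u v = 3"
proof -
  obtain a b where "a \<in> A" "b \<in> B" using nonempty by auto
  then show ?thesis
    using disjoint by (intro graph_dist_3[of _ u b a] pair_wf_digraph_complement) (auto simp: co_arc_iff)
qed

text \<open>Any leaf \<open>b\<close> at the other center is a common neighbour of \<open>u\<close>
  and \<open>a\<close> in the complement.\<close>

lemma dist_center_leaf: "a \<in> A \<Longrightarrow> graph_dist (complement G) u a = 2"
  and dist_leaf_center: "a \<in> A \<Longrightarrow> graph_dist (complement G) a u = 2"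
proof -
  assume a: "a \<in> A"
  obtain b where b: "b \<in> B" using nonempty by auto
  show "graph_dist (complement G) u a = 2"
    using disjoint a b
    by (intro graph_dist_2[of _ u b] pair_wf_digraph_complement) (auto simp: co_arc_iff)
  show "graph_dist (complement G) a u = 2"
    using disjoint a b
    by (intro graph_dist_2[of _ a b] pair_wf_digraph_complement) (auto simp: co_arc_iff)
qed

lemma dist_co_arc: "(x, y) \<in> parcs (complement G) \<Longrightarrow> graph_dist (complement G) x y = 1"
  by (intro graph_dist_1 pair_wf_digraph_complement) (auto simp: co_arc_iff)

lemma dist_self: "x \<in> pverts G \<Longrightarrow> graph_dist (complement G) x x = 0"
  using graph_dist_self[OF pair_wf_digraph_complement] by simp

lemma ecc_center: "ecc (complement G) u = 3"
proof (rule ecc_eqI)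
  show "graph_dist (complement G) u v = 3" by (rule dist_centers)
  fix w assume "w \<in> pverts (complement G)"
  then consider "w = u" | "w = v" | "w \<in> A" | "w \<in> B" by (auto simp: pverts_eq)
  then show "graph_dist (complement G) u w \<le> 3"
  proof cases
    case 4
    then have "(u, w) \<in> parcs (complement G)" using disjoint by (auto simp: co_arc_iff)
    then show ?thesis by (simp add: dist_co_arc)
  qed (auto simp: dist_self dist_centers dist_center_leaf pverts_eq)
qed (auto simp: pverts_eq finite_leaves)

text \<open>The center \<open>u\<close> is the only other vertex that is not adjacent to
  \<open>a\<close> in the complement.\<close>

lemma ecc_leaf:
  assumes a: "a \<in> A"
  shows "ecc (complement G) a = 2"
proof (rule ecc_eqI)
  show "graph_dist (complement G) a u = 2" by (rule dist_leaf_center[OF a])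
  fix w assume "w \<in> pverts (complement G)"
  then consider "w = u" | "w = a" | "(a, w) \<in> parcs (complement G)"
    using a disjoint by (auto simp: pverts_eq co_arc_iff)
  then show "graph_dist (complement G) a w \<le> 2"
    by cases (use a in \<open>auto simp: dist_self dist_co_arc dist_leaf_center pverts_eq\<close>)
qed (auto simp: pverts_eq finite_leaves)

lemma ecc_ge_2:
  assumes "x \<in> pverts G"
  shows "ecc (complement G) x \<ge> 2"
proof -
  interpret swp: double_star G v u B A by (rule swap)
  show ?thesis using assms ecc_center ecc_leaf swp.ecc_center swp.ecc_leaf by (auto simp: pverts_eq)
qed

lemma ecc_entry_arc:
  assumes "(x, y) \<in> parcs (complement G)"
  shows "ecc_entry (complement G) x y = 0"
proof -
  have "2 \<le> min (ecc (complement G) x) (ecc (complement G) y)"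
    using assms by (intro min.boundedI ecc_ge_2) (auto simp: parcs_complement)
  moreover have "\<not> (2::ereal) \<le> 1" by simp
  ultimately show ?thesis unfolding ecc_entry_def dist_co_arc[OF assms] by metis
qed

lemma ecc_entry_same: "x \<in> pverts G \<Longrightarrow> ecc_entry (complement G) x x = 0"
  by (simp add: ecc_entry_def dist_self)

lemma ecc_entry_centers: "ecc_entry (complement G) u v = 3"
  using ecc_center double_star.ecc_center[OF swap] dist_centers by (simp add: ecc_entry_def)

text \<open>The center has eccentricity 3, but the minimum is the eccentricity 2 of the leaf, which
  equals the distance.\<close>

lemma ecc_entry_center_leaf:
  assumes "a \<in> A"
  shows "ecc_entry (complement G) u a = 2" "ecc_entry (complement G) a u = 2"
  using ecc_center ecc_leaf[OF assms] dist_center_leaf[OF assms] dist_leaf_center[OF assms]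
  by (auto simp: ecc_entry_def min_def)

lemma sum_pverts: "(\<Sum>w\<in>pverts G. h w) = h u + h v + sum h A + sum h B"
  for h :: "'a \<Rightarrow> real"
  using finite_leaves disjoint by (simp add: pverts_eq sum.union_disjoint)

lemma row_center:
  "(\<Sum>w\<in>pverts G. ecc_entry (complement G) u w * f w) = 3 * f v + 2 * sum f A"
proof -
  have "ecc_entry (complement G) u b = 0" if "b \<in> B" for b
    using that disjoint by (intro ecc_entry_arc) (auto simp: co_arc_iff)
  then have "(\<Sum>b\<in>B. ecc_entry (complement G) u b * f b) = 0" by simp
  moreover have "(\<Sum>a\<in>A. ecc_entry (complement G) u a * f a) = 2 * sum f A"
    by (simp add: ecc_entry_center_leaf sum_distrib_left)
  ultimately show ?thesis
    using ecc_entry_same[of u] by (simp add: sum_pverts ecc_entry_centers mem_pverts)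
qed

lemma row_leaf:
  assumes a: "a \<in> A"
  shows "(\<Sum>w\<in>pverts G. ecc_entry (complement G) a w * f w) = 2 * f u"
proof -
  have z: "ecc_entry (complement G) a w = 0" if "w \<in> insert v (A \<union> B)" for w
  proof (cases "w = a")
    case True
    then show ?thesis using a by (simp add: ecc_entry_same pverts_eq)
  next
    case False
    then show ?thesis using a that by (intro ecc_entry_arc) (auto simp: co_arc_iff)
  qed
  then have "(\<Sum>w\<in>A. ecc_entry (complement G) a w * f w) = 0"
    "(\<Sum>w\<in>B. ecc_entry (complement G) a w * f w) = 0" by auto
  then show ?thesis using z a by (simp add: sum_pverts ecc_entry_center_leaf)
qed

end

section \<open>The spectrum for double stars\<close>

text \<open>The square of the largest eigenvalue is the larger root of
  \<open>t\<^sup>2 - (4 n + 1) t + 16 q\<close>, where \<open>q\<close> is the product of the numbers of leaves at the two centers.\<close>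

definition double_star_xi1 :: "nat \<Rightarrow> nat \<Rightarrow> real" where
  "double_star_xi1 n q = sqrt ((4 * real n + 1 + sqrt ((4 * real n + 1)\<^sup>2 - 64 * real q)) / 2)"

text \<open>With a + b + 2 vertices the discriminant is 16 (a - b)^2 + 72 (a + b) + 81.\<close>

lemma double_star_discriminant_nonneg: "64 * real (a * b) \<le> (4 * real (a + b + 2) + 1)\<^sup>2"
proof -
  have "(4 * real (a + b + 2) + 1)\<^sup>2 =
      64 * real (a * b) + ((4 * (real a - real b))\<^sup>2 + 72 * (real a + real b) + 81)"
    by (simp add: power2_eq_square algebra_simps)
  moreover have "(4 * (real a - real b))\<^sup>2 + 72 * (real a + real b) + 81 \<ge> 0"
    by (intro add_nonneg_nonneg) simp_all
  ultimately show ?thesis by linarith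
qed

context double_star
begin

text \<open>Each leaf value is determined by its center, which leaves two linear equations in
  \<open>f u\<close> and \<open>f v\<close>. Multiplying them gives the claim after cancelling
  \<open>f u * f v\<close>: if one center value vanished, so would the other and then all leaf
  values.\<close>

lemma eigenvalue_eq:
  fixes x :: real
  assumes f: "\<exists>w\<in>pverts G. f w \<noteq> 0"
    and ev: "\<forall>w\<in>pverts G. (\<Sum>z\<in>pverts G. ecc_entry (complement G) w z * f z) = x * f w"
    and x: "x \<noteq> 0"
  shows "(x\<^sup>2 - 4 * card A) * (x\<^sup>2 - 4 * card B) = 9 * x\<^sup>2"
proof -
  interpret swp: double_star G v u B A by (rule swap)
  have A: "x * f a = 2 * f u" if "a \<in> A" for a
    using bspec[OF ev, of a] row_leaf[OF that, of f] mem_pverts that by auto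
  have B: "x * f b = 2 * f v" if "b \<in> B" for b
    using bspec[OF ev, of b] swp.row_leaf[OF that, of f] mem_pverts that by auto
  have "x * f u = 3 * f v + 2 * sum f A" "x * f v = 3 * f u + 2 * sum f B"
    using bspec[OF ev, of u] bspec[OF ev, of v] row_center[of f] swp.row_center[of f] mem_pverts by auto
  \<comment> \<open>The extra factor \<open>x\<close> lets \<open>A\<close> and \<open>B\<close>
    replace the leaf values without division.\<close>
  then have "x * (x * f u) = 3 * x * f v + 2 * (\<Sum>a\<in>A. x * f a)"
    "x * (x * f v) = 3 * x * f u + 2 * (\<Sum>b\<in>B. x * f b)"
    by (simp_all add: algebra_simps flip: sum_distrib_left)
  then have uv: "(x\<^sup>2 - 4 * card A) * f u = 3 * x * f v" "(x\<^sup>2 - 4 * card B) * f v = 3 * x * f u"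
    by (simp_all add: A B algebra_simps power2_eq_square)
  have nz: "f u \<noteq> 0 \<or> f v \<noteq> 0"
  proof (rule ccontr)
    assume "\<not> ?thesis"
    then have "f w = 0" if "w \<in> pverts G" for w
      using that A[of w] B[of w] x by (auto simp: pverts_eq)
    then show False using f by blast
  qed
  then have "f u \<noteq> 0" "f v \<noteq> 0" using uv x by auto
  moreover have "(x\<^sup>2 - 4 * card A) * (x\<^sup>2 - 4 * card B) * (f u * f v) = 9 * x\<^sup>2 * (f u * f v)"
    using arg_cong2[OF uv, of "(*)"] by (simp add: power2_eq_square mult_ac)
  ultimately show ?thesis by simp
qed

lemma eigenvector:
  fixes x :: real
  assumes x: "x \<noteq> 0" and eq: "(x\<^sup>2 - 4 * card A) * (x\<^sup>2 - 4 * card B) = 9 * x\<^sup>2"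
  shows "\<exists>f. (\<exists>w\<in>pverts G. f w \<noteq> 0) \<and>
    (\<forall>w\<in>pverts G. (\<Sum>z\<in>pverts G. ecc_entry (complement G) w z * f z) = x * f w)"
proof -
  interpret swp: double_star G v u B A by (rule swap)
  define y where "y = x\<^sup>2 - 4 * card A"
  \<comment> \<open>The eigenvector is scaled so that \<open>f u\<close> is \<open>3 * x\<close>.
    The rows of the leaves in \<open>A\<close> then force the value 6, the row of \<open>u\<close>
    forces \<open>y\<close> at \<open>v\<close>, and the rows of \<open>B\<close> force
    \<open>2 * y / x\<close>. The hypothesis \<open>eq\<close> enters in the remaining row, that of
    \<open>v\<close>.\<close>
  define f where "f w = (if w = u then 3 * x else if w = v then y
    else if w \<in> A then 6 else 2 * y / x)" for w
  have f: "f u = 3 * x" "f v = y" "\<And>a. a \<in> A \<Longrightarrow> f a = 6" "\<And>b. b \<in> B \<Longrightarrow> f b = 2 * y / x"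
    using disjoint by (auto simp: f_def)
  have "(\<Sum>z\<in>pverts G. ecc_entry (complement G) w z * f z) = x * f w" if "w \<in> pverts G" for w
  proof -
    consider "w = u" | "w = v" | "w \<in> A" | "w \<in> B" using \<open>w \<in> pverts G\<close> by (auto simp: pverts_eq)
    then show ?thesis
    proof cases
      case 1
      then show ?thesis by (simp add: row_center f y_def power2_eq_square)
    next
      case 2
      have "x * (2 * y / x) = 2 * y" using x by simp
      moreover have "sum f B = card B * (2 * y / x)" by (simp add: f)
      ultimately have "x * sum f B = card B * (2 * y)" by (metis mult.left_commute)
      then have "x * (3 * f u + 2 * sum f B) = x * (x * f v)"
        using eq by (simp add: f(1,2) y_def power2_eq_square algebra_simps)
      then show ?thesis using 2 x by (simp add: swp.row_center)
    next
      case 3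
      then show ?thesis by (simp add: row_leaf f)
    next
      case 4
      then show ?thesis using x by (simp add: swp.row_leaf f)
    qed
  qed
  moreover have "\<exists>w\<in>pverts G. f w \<noteq> 0" using x by (auto simp: pverts_eq f)
  ultimately show ?thesis by blast
qed

text \<open>In t = x^2 the eigenvalue equation is quadratic; completing the square
  (\<open>quad\<close>) shows that \<open>Y\<close> is its larger root.\<close>

lemma xi1_complement: "xi1 (complement G) = double_star_xi1 (card (pverts G)) (card A * card B)"
proof -
  let ?n = "real (card (pverts G))"
  define D where "D = (4 * ?n + 1)\<^sup>2 - 64 * real (card A * card B)"
  define Y where "Y = (4 * ?n + 1 + sqrt D) / 2"
  have n: "?n = real (card A) + real (card B) + 2" by (simp add: card_pverts)
  have D: "D \<ge> 0"
    using double_star_discriminant_nonneg[of "card A" "card B"] by (simp add: D_def card_pverts)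
  have Y: "Y > 0" using D by (simp add: Y_def add_pos_nonneg)
  have quad: "(t - 4 * card A) * (t - 4 * card B) = 9 * t \<longleftrightarrow> (2 * t - (4 * ?n + 1))\<^sup>2 = D" for t :: real
    unfolding D_def n by (auto simp: power2_eq_square algebra_simps)
  have xi: "double_star_xi1 (card (pverts G)) (card A * card B) = sqrt Y"
    by (simp add: double_star_xi1_def Y_def D_def)
  have "2 * Y - (4 * ?n + 1) = sqrt D" by (simp add: Y_def field_simps)
  then have "(2 * Y - (4 * ?n + 1))\<^sup>2 = D" using D by simp
  then obtain f where f: "\<exists>w\<in>pverts G. f w \<noteq> 0"
    "\<forall>w\<in>pverts G. (\<Sum>z\<in>pverts G. ecc_entry (complement G) w z * f z) = sqrt Y * f w"
    using eigenvector[of "sqrt Y"] Y quad by auto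
  show ?thesis
    unfolding xi
  proof (rule xi1_eqI)
    fix y g assume g: "\<exists>w\<in>pverts (complement G). g w \<noteq> 0"
      "\<forall>w\<in>pverts (complement G). (\<Sum>z\<in>pverts (complement G). ecc_entry (complement G) w z * g z) = y * g w"
    show "y \<le> sqrt Y"
    \<comment> \<open>The quadratic equation is available only for nonzero eigenvalues.\<close>
    proof (cases "y = 0")
      case True
      then show ?thesis using Y by simp
    next
      case False
      then have "(2 * y\<^sup>2 - (4 * ?n + 1))\<^sup>2 = D"
        using eigenvalue_eq[of g y] g quad[of "y\<^sup>2"] by simp
      then have "2 * y\<^sup>2 - (4 * ?n + 1) \<le> sqrt D" by (metis real_sqrt_abs abs_ge_self)
      then have "y\<^sup>2 \<le> Y" by (simp add: Y_def)
      then show ?thesis by (rule real_le_rsqrt)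
    qed
  qed (use f finite_pverts in auto)
qed

end

section \<open>Comparing the candidate values\<close>

lemma double_star_xi1_less:
  assumes "64 * real q' \<le> (4 * real n + 1)\<^sup>2" "q < q'"
  shows "double_star_xi1 n q' < double_star_xi1 n q"
  using assms unfolding double_star_xi1_def by simp

lemma less_double_star_xi1:
  assumes "n \<ge> 4"
  shows "sqrt (4 * (real n - 1)) < double_star_xi1 n (n - 3)"
proof -
  \<comment> \<open>The term 4n - 9 is 8(n - 1) - (4n + 1), obtained by solving the claim for the
    inner root. The two sides differ by 16n + 112.\<close>
  have "(4 * real n - 9)\<^sup>2 < (4 * real n + 1)\<^sup>2 - 64 * real (n - 3)"
    using assms by (simp add: of_nat_diff power2_eq_square algebra_simps)
  then have "4 * real n - 9 < sqrt ((4 * real n + 1)\<^sup>2 - 64 * real (n - 3))"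
    by (rule real_less_rsqrt)
  then have "4 * (real n - 1) < (4 * real n + 1 + sqrt ((4 * real n + 1)\<^sup>2 - 64 * real (n - 3))) / 2"
    by simp
  then show ?thesis
    unfolding double_star_xi1_def by (rule real_sqrt_less_mono)
qed

text \<open>The path end 3 is a leaf at 2 like the attached vertices, so the leaf counts are 1 and n
  - 3.\<close>

lemma double_star_T_n3:
  assumes "n \<ge> 4"
  shows "double_star (T_n3 n) 1 2 {0} {3..<n}"
proof
  have "{3..<n} = insert 3 {4..<n}" using assms by auto
  then show "parcs (T_n3 n) = symcl (insert (1, 2) ({1} \<times> {0} \<union> {2} \<times> {3..<n}))"
    by (simp add: T_n3_def symcl_def) blast
qed (use assms in \<open>auto simp: T_n3_def\<close>)

subsection \<open>Isomorphisms of double stars\<close>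

lemma map_prod_symcl: "map_prod f f ` symcl R = symcl (map_prod f f ` R)"
  by (simp add: symcl_def image_Un image_image split_beta)

text \<open>Centers are mapped to centers, and bijections between the leaf sets supply the rest of
  the vertex map.\<close>

lemma double_star_iso:
  assumes G: "double_star G u v A B" and H: "double_star H u' v' A' B'"
    and card: "card A = card A'" "card B = card B'"
  shows "digraph_iso (with_proj G) (with_proj H)"
proof -
  interpret G: double_star G u v A B by fact
  interpret H: double_star H u' v' A' B' by fact
  obtain g h where g: "bij_betw g A A'" and h: "bij_betw h B B'"
    using card G.finite_leaves H.finite_leaves by (metis finite_same_card_bij)
  define f where "f x = (if x = u then u' else if x = v then v' else if x \<in> A then g x else h x)" for x
  have f: "f u = u'" "f v = v'" "\<And>x. x \<in> A \<Longrightarrow> f x = g x" "\<And>x. x \<in> B \<Longrightarrow> f x = h x"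
    using G.disjoint by (auto simp: f_def)
  have img: "f ` A = A'" "f ` B = B'"
    using f g h by (auto simp: bij_betw_def)
  have "inj_on f A" "inj_on f B"
    using f g h by (auto simp: bij_betw_def inj_on_def)
  then have inj: "inj_on f (pverts G)"
    unfolding G.pverts_eq using img H.disjoint f(1,2)
    by (auto simp: inj_on_Un inj_on_insert)
  let ?hom = "\<lparr>iso_verts = f, iso_arcs = map_prod f f, iso_head = snd, iso_tail = fst\<rparr>"
  have wf: "pair_wf_digraph G"
    by unfold_locales (auto simp: G.arc_iff G.pverts_eq)
  have "parcs G \<subseteq> pverts G \<times> pverts G"
    by (auto simp: G.arc_iff G.pverts_eq)
  then have "inj_on (map_prod f f) (parcs G)"
    by (rule inj_on_subset[OF map_prod_inj_on[OF inj inj]])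
  then have "pre_digraph.digraph_isomorphism (with_proj G) ?hom"
    using wf inj by (auto simp: pre_digraph.digraph_isomorphism_def wf_digraph_wp_iff)
  moreover have "with_proj H = app_iso ?hom (with_proj G)"
  proof -
    have "map_prod f f ` parcs G = parcs H"
      using img f(1,2) by (simp add: G.parcs_eq H.parcs_eq map_prod_symcl image_Un map_prod_surj_on[OF refl refl])
    moreover have "f ` pverts G = pverts H"
      using img f(1,2) by (simp add: G.pverts_eq H.pverts_eq image_Un)
    ultimately show ?thesis by (simp add: app_iso_def with_proj_def)
  qed
  ultimately show ?thesis unfolding digraph_iso_def by blast
qed

text \<open>An isomorphic copy is again a double star with the same leaf counts, so the formula for
  \<open>xi1\<close> applies to it directly. This replaces a general proof that \<open>xi1\<close>
  is invariant under isomorphism.\<close>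

lemma double_star_iso_image:
  assumes G: "double_star G u v A B" and iso: "digraph_iso (with_proj G) (with_proj H)"
  shows "\<exists>u' v' A' B'. double_star H u' v' A' B' \<and> card A' = card A \<and> card B' = card B"
proof -
  interpret G: double_star G u v A B by fact
  obtain hom where hom: "pre_digraph.digraph_isomorphism (with_proj G) hom"
    and H: "with_proj H = app_iso hom (with_proj G)"
    using iso by (auto simp: digraph_iso_def)
  define f where "f = iso_verts hom"
  have inj: "inj_on f (pverts G)"
    using hom by (simp add: pre_digraph.digraph_isomorphism_def f_def)
  have V: "pverts H = f ` pverts G"
    using arg_cong[OF H, of verts] by (simp add: f_def)
  \<comment> \<open>Head and tail in \<open>H\<close> are again the projections, so
    \<open>hom\<close> must act on arcs through its vertex map.\<close>
  have "iso_tail hom = fst" "iso_head hom = snd"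
    using arg_cong[OF H, of tail] arg_cong[OF H, of head] by simp_all
  then have "iso_arcs hom a = map_prod f f a" if "a \<in> parcs G" for a
    using hom that by (auto simp: pre_digraph.digraph_isomorphism_def f_def prod_eq_iff)
  moreover have "parcs H = iso_arcs hom ` parcs G"
    using arg_cong[OF H, of arcs] by simp
  ultimately have E: "parcs H = map_prod f f ` parcs G" by auto
  have "double_star H (f u) (f v) (f ` A) (f ` B)"
  proof
    show "pverts H = insert (f u) (insert (f v) (f ` A \<union> f ` B))"
      by (simp add: V G.pverts_eq image_Un)
    show "parcs H = symcl (insert (f u, f v) ({f u} \<times> f ` A \<union> {f v} \<times> f ` B))"
      by (simp add: E G.parcs_eq map_prod_symcl image_Un map_prod_surj_on[OF refl refl])
    show "f ` A \<inter> f ` B = {}"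
      using inj G.disjoint(1) G.mem_pverts by (metis image_empty inj_on_image_Int)
    show "f u \<notin> f ` A \<union> f ` B" "f v \<notin> f ` A \<union> f ` B" "f u \<noteq> f v"
      using inj G.disjoint by (auto simp: G.pverts_eq inj_on_def)
  qed (use G.finite_leaves G.nonempty in auto)
  moreover have "card (f ` A) = card A" "card (f ` B) = card B"
    using inj G.mem_pverts by (meson card_image inj_on_subset)+
  ultimately show ?thesis by blast
qed

subsection \<open>Trees\<close>

lemma undirected_tree_no_triangle:
  assumes T: "undirected_tree T" and arcs: "(a, b) \<in> parcs T" "(b, c) \<in> parcs T"
  shows "(c, a) \<notin> parcs T"
proof
  assume ca: "(c, a) \<in> parcs T"
  interpret pair_graph T using T by (simp add: undirected_tree_def)
  have "a \<noteq> b" "b \<noteq> c" "c \<noteq> a" using arcs ca pair_no_loops by fastforce+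
  then have "cycle [(a, b), (b, c), (c, a)]"
    using arcs ca in_arcsD1 by (auto simp: cycle_def awalk_def intro!: exI[of _ a])
  then show False using T by (fastforce simp: undirected_tree_def)
qed

text \<open>The two alternatives are the closed walks of length 4 that retrace an edge; any other
  would be a cycle.\<close>

lemma undirected_tree_no_4_cycle:
  assumes T: "undirected_tree T"
    and arcs: "(a, b) \<in> parcs T" "(b, c) \<in> parcs T" "(c, d) \<in> parcs T" "(d, a) \<in> parcs T"
  shows "a = c \<or> b = d"
proof (rule ccontr)
  assume ne: "\<not> ?thesis"
  interpret pair_graph T using T by (simp add: undirected_tree_def)
  have "a \<noteq> b" "b \<noteq> c" "c \<noteq> d" "d \<noteq> a" using arcs pair_no_loops by fastforce+
  then have "cycle [(a, b), (b, c), (c, d), (d, a)]"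
    using arcs ne in_arcsD1 by (auto simp: cycle_def awalk_def intro!: exI[of _ a])
  then show False using T by (fastforce simp: undirected_tree_def)
qed

lemma undirected_tree_neighbour:
  assumes T: "undirected_tree T" and card: "card (pverts T) \<ge> 2" and u: "u \<in> pverts T"
  shows "\<exists>v. (u, v) \<in> parcs T"
proof -
  interpret pair_graph T using T by (simp add: undirected_tree_def)
  obtain w where w: "w \<in> pverts T" "w \<noteq> u"
    using card u by (metis card_le_Suc0_iff_eq not_less_eq_eq numeral_2_eq_2 pair_finite_verts)
  have "u \<rightarrow>\<^sup>*\<^bsub>mk_symmetric T\<^esub> w"
    using T u w by (auto simp: undirected_tree_def connected_def strongly_connected_def)
  \<comment> \<open>Connectedness refers to the symmetric closure, which has the same reachability
    since the arcs of \<open>T\<close> are already symmetric.\<close>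
  then have "u \<rightarrow>\<^sup>*\<^bsub>T\<^esub> w"
    using reachable_mk_symmetric_eq[OF sym_arcs] by simp
  then show ?thesis
    using w(2) by (cases rule: converse_reachable_cases) auto
qed

lemma in_symcl_iff: "(x, y) \<in> symcl R \<longleftrightarrow> (x, y) \<in> R \<or> (y, x) \<in> R"
  by (auto simp: symcl_def)

text \<open>Every further vertex is attached to \<open>u\<close> or \<open>v\<close>. Edges avoiding
  both centers would close a triangle or a 4-cycle, and an empty leaf set would make
  \<open>T\<close> a star.\<close>

lemma double_starI_dominating_edge:
  assumes T: "undirected_tree T"
    and star: "\<not> complete_bipartite_digraph 1 (card (pverts T) - 1) (with_proj T)"
    and uv: "(u, v) \<in> parcs T"
    and dom: "\<And>w. w \<in> pverts T \<Longrightarrow> w \<noteq> u \<Longrightarrow> w \<noteq> v \<Longrightarrow> (u, w) \<in> parcs T \<or> (v, w) \<in> parcs T"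
  shows "\<exists>A B. double_star T u v A B"
proof -
  interpret pair_graph T using T by (simp add: undirected_tree_def)
  note no3 = undirected_tree_no_triangle[OF T] and no4 = undirected_tree_no_4_cycle[OF T]
  have sym: "(b, a) \<in> parcs T" if "(a, b) \<in> parcs T" for a b using that arcs_symmetric by blast
  have irr: "(a, a) \<notin> parcs T" for a using pair_no_loops by fastforce
  have V: "u \<in> pverts T" "v \<in> pverts T" "u \<noteq> v"
    using uv in_arcsD1 in_arcsD2 irr by auto
  \<comment> \<open>If \<open>c\<close> were adjacent to all other vertices, an edge avoiding
    \<open>c\<close> would close a triangle, so \<open>T\<close> would be a star.\<close>
  have not_center: "\<exists>w\<in>pverts T. w \<noteq> c \<and> (c, w) \<notin> parcs T" if c: "c \<in> pverts T" for c
  proof (rule ccontr)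
    assume "\<not> ?thesis"
    then have all: "(c, w) \<in> parcs T" if "w \<in> pverts T" "w \<noteq> c" for w using that by blast
    have "parcs T = {c} \<times> (pverts T - {c}) \<union> (pverts T - {c}) \<times> {c}"
    proof (intro subset_antisym subrelI)
      fix x y assume xy: "(x, y) \<in> parcs T"
      then have mem: "x \<in> pverts T" "y \<in> pverts T" "x \<noteq> y" using in_arcsD1 in_arcsD2 irr by auto
      then show "(x, y) \<in> {c} \<times> (pverts T - {c}) \<union> (pverts T - {c}) \<times> {c}"
        using xy all[of x] all[of y] no3[of c x y] sym by auto
    qed (use all sym in blast)
    then have "complete_bipartite_digraph 1 (card (pverts T) - 1) (with_proj T)"
      unfolding complete_bipartite_digraph_pair_def
    proof (intro conjI exI)
      show "pverts T = {c} \<union> (pverts T - {c})" using c by blast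
      show "card (pverts T - {c}) = card (pverts T) - 1" using c pair_finite_verts by simp
    qed (simp_all add: pair_finite_verts)
    then show False using star by simp
  qed
  define A where "A = {w. (u, w) \<in> parcs T \<and> w \<noteq> v}"
  define B where "B = {w. (v, w) \<in> parcs T \<and> w \<noteq> u}"
  have "double_star T u v A B"
  proof
    show "pverts T = insert u (insert v (A \<union> B))"
      using V dom in_arcsD2 by (auto simp: A_def B_def)
    show "parcs T = symcl (insert (u, v) ({u} \<times> A \<union> {v} \<times> B))"
    proof (intro subset_antisym subrelI)
      fix x y assume xy: "(x, y) \<in> parcs T"
      then have mem: "x \<in> pverts T" "y \<in> pverts T" "x \<noteq> y" using in_arcsD1 in_arcsD2 irr by auto
      have "x = u \<or> x = v \<or> y = u \<or> y = v"
      proof (rule ccontr)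
        assume *: "\<not> ?thesis"
        then have "(u, x) \<in> parcs T \<or> (v, x) \<in> parcs T" "(u, y) \<in> parcs T \<or> (v, y) \<in> parcs T"
          using dom mem by auto
        \<comment> \<open>If \<open>x\<close> and \<open>y\<close> hang on the same center, they
          form a triangle with it; if on different ones, \<open>xy\<close> and \<open>uv\<close> lie
          on a 4-cycle.\<close>
        then show False
          using * xy uv sym no3[of u x y] no3[of v x y] no4[of u x y v] no4[of v x y u] by blast
      qed
      then show "(x, y) \<in> symcl (insert (u, v) ({u} \<times> A \<union> {v} \<times> B))"
        using xy sym[OF xy] mem by (auto simp: in_symcl_iff A_def B_def)
    next
      fix x y assume "(x, y) \<in> symcl (insert (u, v) ({u} \<times> A \<union> {v} \<times> B))"
      then show "(x, y) \<in> parcs T"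
        using uv sym unfolding in_symcl_iff A_def B_def by blast
    qed
    show "finite A" "finite B"
      using in_arcsD2 by (auto intro!: finite_subset[OF _ pair_finite_verts] simp: A_def B_def)
    show "A \<noteq> {}" using not_center[OF V(2)] dom sym[OF uv] by (auto simp: A_def)
    show "B \<noteq> {}" using not_center[OF V(1)] dom uv by (auto simp: B_def)
    show "A \<inter> B = {}" using no3 sym uv unfolding A_def B_def by blast
  qed (use V irr in \<open>auto simp: A_def B_def\<close>)
  then show ?thesis by blast
qed

text \<open>All edges have entry 2, so \<open>eigenvalue_sq_le\<close> applies with c = 2. Symmetry
  of the entries ensures that \<open>xi1\<close> really is an eigenvalue.\<close>

lemma xi1_complement_le_no_dominating_edge:
  assumes T: "undirected_tree T" and card: "card (pverts T) \<ge> 2"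
    and nodom: "\<And>u v. (u, v) \<in> parcs T \<Longrightarrow>
      \<exists>w\<in>pverts T. w \<noteq> u \<and> w \<noteq> v \<and> (u, w) \<notin> parcs T \<and> (v, w) \<notin> parcs T"
  shows "xi1 (complement T) \<le> sqrt (4 * (real (card (pverts T)) - 1))"
proof -
  interpret pair_graph T using T by (simp add: undirected_tree_def)
  have G: "pair_graph T" by unfold_locales
  note entry = ecc_entry_complement_no_dominating_edge[OF G undirected_tree_neighbour[OF T card] nodom]
  have "pverts T \<noteq> {}" using card by auto
  moreover have "ecc_entry (complement T) u v = ecc_entry (complement T) v u"
    if "u \<in> pverts T" "v \<in> pverts T" for u v
    using entry that arcs_symmetric[of u v] arcs_symmetric[of v u] by auto
  ultimately obtain f where f: "\<exists>v\<in>pverts T. f v \<noteq> 0"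
    "\<And>u. u \<in> pverts T \<Longrightarrow>
      (\<Sum>v\<in>pverts T. ecc_entry (complement T) u v * f v) = xi1 (complement T) * f u"
    using xi1_eigenvector[of "complement T", unfolded pverts_complement, OF pair_finite_verts] by blast
  have "(xi1 (complement T))\<^sup>2 \<le> 2\<^sup>2 * (real (card (pverts T)) - 1)"
  proof (rule eigenvalue_sq_le[OF G])
    show "(\<Sum>v\<in>pverts T. (if (u, v) \<in> parcs T then 2 else 0) * f v) = xi1 (complement T) * f u"
      if "u \<in> pverts T" for u
      unfolding f(2)[OF that, symmetric] by (rule sum.cong) (simp_all add: entry that)
  qed (use undirected_tree_no_triangle[OF T] undirected_tree_no_4_cycle[OF T] f(1) in blast)+
  then show ?thesis by (intro real_le_rsqrt) simp
qed

theorem theorem3p5: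
  fixes T :: "'a pair_pre_digraph" and n :: nat
  assumes "undirected_tree T"
    and "card (pverts T) = n"
    and "n \<ge> 4"
    and "\<not> complete_bipartite_digraph 1 (n - 1) (with_proj T)"
  shows "xi1 (complement T) \<le> xi1 (complement (T_n3 n)) \<and>
    (xi1 (complement T) = xi1 (complement (T_n3 n)) \<longleftrightarrow>
      digraph_iso (with_proj T) (with_proj (T_n3 n)))"
proof -
  interpret pair_graph T using assms(1) by (simp add: undirected_tree_def)
  interpret S: double_star "T_n3 n" 1 2 "{0}" "{3..<n}" using double_star_T_n3 assms(3) .
  have xiS: "xi1 (complement (T_n3 n)) = double_star_xi1 n (n - 3)"
    using S.xi1_complement by (simp add: T_n3_def)
  \<comment> \<open>This gives equality in the extremal case; in the other cases the strict
    inequality then excludes an isomorphism.\<close>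
  have iso_xi: "xi1 (complement T) = xi1 (complement (T_n3 n))"
    if "digraph_iso (with_proj T) (with_proj (T_n3 n))"
  proof -
    have "digraph_iso (with_proj (T_n3 n)) (with_proj T)"
      using digraph_iso_swap[OF _ that] wf_digraph_axioms by simp
    then obtain u v A B where D: "double_star T u v A B" "card A = 1" "card B = n - 3"
      using double_star_iso_image[OF S.double_star_axioms] by fastforce
    then show ?thesis using double_star.xi1_complement[OF D(1)] assms(2) xiS by simp
  qed
  show ?thesis
  proof (cases "\<exists>u v. (u, v) \<in> parcs T \<and>
      (\<forall>w\<in>pverts T. w \<noteq> u \<longrightarrow> w \<noteq> v \<longrightarrow> (u, w) \<in> parcs T \<or> (v, w) \<in> parcs T)")
    case True
    then obtain u v A B where "double_star T u v A B"
      using double_starI_dominating_edge[OF assms(1)] assms(2,4) by metis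
    then interpret D: double_star T u v A B .
    have ab: "card A + card B = n - 2" using D.card_pverts assms(2) by simp
    have ge1: "card A \<ge> 1" "card B \<ge> 1"
      using D.finite_leaves D.nonempty by (simp_all add: Suc_le_eq card_gt_0_iff)
    have xiT: "xi1 (complement T) = double_star_xi1 n (card A * card B)"
      using D.xi1_complement assms(2) by simp
    \<comment> \<open>Writing the leaf counts as k + 1 and l + 1 with k + l = n - 4 turns their
      product into n - 3 + kl, which is minimal exactly when one center has a single leaf.\<close>
    obtain k l where kl: "card A = Suc k" "card B = Suc l" using ge1 by (metis Suc_le_D One_nat_def)
    have q: "card A * card B = n - 3 + k * l" using ab kl assms(3) by simp
    show ?thesis
    proof (cases "k * l = 0")
      case True
      have "digraph_iso (with_proj T) (with_proj (T_n3 n))"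
      proof (cases "k = 0")
        case True
        then show ?thesis
          using ab kl by (intro double_star_iso[OF D.double_star_axioms S.double_star_axioms]) auto
      next
        \<comment> \<open>Here \<open>l\<close> is 0, so the single leaf hangs on \<open>v\<close>
          and the centers change roles.\<close>
        case False
        then show ?thesis
          using ab kl True by (intro double_star_iso[OF D.swap S.double_star_axioms]) auto
      qed
      then show ?thesis using iso_xi by simp
    next
      case False
      have "card A + card B + 2 = n" using ab assms(3) by simp
      then have "64 * real (card A * card B) \<le> (4 * real n + 1)\<^sup>2"
        using double_star_discriminant_nonneg[of "card A" "card B"] by simp
      then have "double_star_xi1 n (card A * card B) < double_star_xi1 n (n - 3)"
        by (rule double_star_xi1_less) (use q False in simp)
      then show ?thesis using xiS xiT iso_xi by auto
    qed
  next
    case False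
    then have "xi1 (complement T) \<le> sqrt (4 * (real n - 1))"
      using xi1_complement_le_no_dominating_edge[OF assms(1)] assms(2,3) by fastforce
    also have "\<dots> < xi1 (complement (T_n3 n))"
      using less_double_star_xi1[OF assms(3)] xiS by simp
    finally show ?thesis using iso_xi by auto
  qed
qed

end
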